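(* Consider the following statement (P): for every bridgeless cubic graph $G$, every pair of adjacent edges $e,f$ of $G$, and all integers $i,j$ with $0\le i,j\le 2$ and $1\le i+j\le 3$, there is an FR-triple $C$ of $G$ with $\nu_C(e)=i$ and $\nu_C(f)=j$. If (P) fails, then every counter-example to (P) with the minimum number of vertices is cyclically $4$-edge-connected.
   Context: Graphs are finite. For a bridgeless cubic graph $G$ and a list $C=(F_1,\dots,F_k)$ of (not necessarily distinct) perfect matchings of $G$, $\nu_C(e)$ denotes the number of indices $t$ with $e\in F_t$. An FR-triple of a bridgeless cubic graph $G$ is a list $C=(F_1,F_2,F_3)$ of (not necessarily distinct) perfect matchings of $G$ such that $F_1\cap F_2\cap F_3=\emptyset$. A counter-example to (P) is a bridgeless cubic graph $G$ together with adjacent edges $e,f$ and integers $i,j$ as in (P) for which no such FR-triple exists. A cubic graph is cyclically $4$-edge-connected if it is $3$-edge-connected and every $3$-edge-cut is trivial, i.e., consists of the three edges incident to a single vertex. *)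

theory Defs
  imports Main
begin

text \<open>Finite undirected graphs, parallel edges allowed. Loops are excluded without loss of
  generality: in a cubic graph the third edge at a vertex carrying a loop is a bridge.\<close>

record ('v, 'e) multigraph =
  verts :: "'v set"
  edges :: "'e set"
  ends :: "'e \<Rightarrow> 'v set"

definition graph :: "('v, 'e) multigraph \<Rightarrow> bool" where
  "graph G \<longleftrightarrow> finite (verts G) \<and> finite (edges G) \<and>
     (\<forall>e\<in>edges G. ends G e \<subseteq> verts G \<and> card (ends G e) = 2)"

definition incident_edges :: "('v, 'e) multigraph \<Rightarrow> 'v \<Rightarrow> 'e set" where
  "incident_edges G v = {e \<in> edges G. v \<in> ends G e}"

definition cubic :: "('v, 'e) multigraph \<Rightarrow> bool" where
  "cubic G \<longleftrightarrow> graph G \<and> (\<forall>v\<in>verts G. card (incident_edges G v) = 3)"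

definition adjacent_edges :: "('v, 'e) multigraph \<Rightarrow> 'e \<Rightarrow> 'e \<Rightarrow> bool" where
  "adjacent_edges G e f \<longleftrightarrow>
     e \<in> edges G \<and> f \<in> edges G \<and> e \<noteq> f \<and> ends G e \<inter> ends G f \<noteq> {}"

definition delete_edges :: "('v, 'e) multigraph \<Rightarrow> 'e set \<Rightarrow> ('v, 'e) multigraph" where
  "delete_edges G F = G\<lparr>edges := edges G - F\<rparr>"

definition reachable :: "('v, 'e) multigraph \<Rightarrow> 'v \<Rightarrow> 'v \<Rightarrow> bool" where
  "reachable G = (\<lambda>u v. \<exists>e\<in>edges G. ends G e = {u, v})\<^sup>*\<^sup>*"

definition connected :: "('v, 'e) multigraph \<Rightarrow> bool" where
  "connected G \<longleftrightarrow> verts G \<noteq> {} \<and> (\<forall>u\<in>verts G. \<forall>v\<in>verts G. reachable G u v)"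

definition bridge :: "('v, 'e) multigraph \<Rightarrow> 'e \<Rightarrow> bool" where
  "bridge G e \<longleftrightarrow> e \<in> edges G \<and>
     (\<exists>u v. ends G e = {u, v} \<and> \<not> reachable (delete_edges G {e}) u v)"

text \<open>Connectedness is not required.\<close>

definition bridgeless_cubic :: "('v, 'e) multigraph \<Rightarrow> bool" where
  "bridgeless_cubic G \<longleftrightarrow> cubic G \<and> (\<forall>e. \<not> bridge G e)"

definition edge_connected :: "nat \<Rightarrow> ('v, 'e) multigraph \<Rightarrow> bool" where
  "edge_connected k G \<longleftrightarrow> card (verts G) > 1 \<and>
     (\<forall>F. F \<subseteq> edges G \<and> card F < k \<longrightarrow> connected (delete_edges G F))"

definition edge_cut :: "('v, 'e) multigraph \<Rightarrow> 'e set \<Rightarrow> bool" where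
  "edge_cut G K \<longleftrightarrow> (\<exists>X. X \<noteq> {} \<and> X \<subset> verts G \<and>
     K = {e \<in> edges G. ends G e \<inter> X \<noteq> {} \<and> ends G e \<inter> (verts G - X) \<noteq> {}})"

definition cyclically_4_edge_connected :: "('v, 'e) multigraph \<Rightarrow> bool" where
  "cyclically_4_edge_connected G \<longleftrightarrow> cubic G \<and> edge_connected 3 G \<and>
     (\<forall>K. edge_cut G K \<and> card K = 3 \<longrightarrow> (\<exists>v\<in>verts G. K = incident_edges G v))"

definition perfect_matching :: "('v, 'e) multigraph \<Rightarrow> 'e set \<Rightarrow> bool" where
  "perfect_matching G F \<longleftrightarrow> F \<subseteq> edges G \<and> (\<forall>v\<in>verts G. \<exists>!e. e \<in> F \<and> v \<in> ends G e)"

definition nu :: "'e set list \<Rightarrow> 'e \<Rightarrow> nat" where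
  "nu C e = card {t. t < length C \<and> e \<in> C ! t}"

definition FR_triple :: "('v, 'e) multigraph \<Rightarrow> 'e set list \<Rightarrow> bool" where
  "FR_triple G C \<longleftrightarrow> (\<exists>F1 F2 F3. C = [F1, F2, F3] \<and> perfect_matching G F1 \<and>
     perfect_matching G F2 \<and> perfect_matching G F3 \<and> F1 \<inter> F2 \<inter> F3 = {})"

text \<open>A closed formula cannot quantify over types, so graphs are taken over the natural numbers
  here; every finite graph is isomorphic to such a one.\<close>

definition property_P :: bool where
  "property_P \<longleftrightarrow> (\<forall>(G :: (nat, nat) multigraph) e f i j.
     bridgeless_cubic G \<and> adjacent_edges G e f \<and>
     i \<le> 2 \<and> j \<le> 2 \<and> 1 \<le> i + j \<and> i + j \<le> 3 \<longrightarrow>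
     (\<exists>C. FR_triple G C \<and> nu C e = i \<and> nu C f = j))"

definition counterexample_P ::
    "('v, 'e) multigraph \<Rightarrow> 'e \<Rightarrow> 'e \<Rightarrow> nat \<Rightarrow> nat \<Rightarrow> bool" where
  "counterexample_P G e f i j \<longleftrightarrow>
     bridgeless_cubic G \<and> adjacent_edges G e f \<and>
     i \<le> 2 \<and> j \<le> 2 \<and> 1 \<le> i + j \<and> i + j \<le> 3 \<and>
     \<not> (\<exists>C. FR_triple G C \<and> nu C e = i \<and> nu C f = j)"

end

theory Submission
  imports Defs
begin

text \<open>In an FR-triple the three edges at a vertex have multiplicities \<open>(0, 1, 2)\<close> in some order or
  \<open>(1, 1, 1)\<close>. Hence (P) says that every choice of three edges at a vertex, not all equal, is realised
  by an FR-triple whose first, second and third matching use the first, second and third of these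
  edges. Suppose a minimal counter-example has an edge cut of size 0 or 2, or a nontrivial one of size
  3. Replacing either side of the cut by nothing, an edge or a vertex, respectively, yields two smaller
  bridgeless cubic graphs, both satisfying (P). The graph that contains the common end of \<open>e\<close> and \<open>f\<close> has
  an FR-triple with the required multiplicities; the other graph has one that agrees with it on the
  cut, matching by matching; and the two glue to an FR-triple of the counter-example.\<close>

section \<open>Cuts\<close>

text \<open>\<open>X\<close> may contain points that are not vertices: later cuts are taken at
  preimages under vertex maps, which range over the whole type.\<close>

definition cut_of :: "('v, 'e) multigraph \<Rightarrow> 'v set \<Rightarrow> 'e set" where
  "cut_of G X = {e \<in> edges G. ends G e \<inter> X \<noteq> {} \<and> \<not> ends G e \<subseteq> X}"

lemma graph_endsE:
  assumes "graph G" "e \<in> edges G" "v \<in> ends G e"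
  obtains u where "ends G e = {v, u}" "u \<noteq> v" "u \<in> verts G" "v \<in> verts G"
proof -
  have "card (ends G e) = 2" "ends G e \<subseteq> verts G"
    using assms unfolding graph_def by auto
  then obtain a b where "ends G e = {a, b}" "a \<noteq> b"
    by (meson card_2_iff)
  with assms(3) \<open>ends G e \<subseteq> verts G\<close> show ?thesis
    using that[of "if v = a then b else a"] by (auto simp: insert_commute)
qed

lemma cut_subset_edges: "cut_of G X \<subseteq> edges G"
  by (auto simp: cut_of_def)

lemma cut_endsE:
  assumes "graph G" "e \<in> cut_of G X"
  obtains u v where "ends G e = {u, v}" "u \<in> X" "v \<notin> X" "u \<in> verts G" "v \<in> verts G"
proof -
  obtain u where u: "u \<in> ends G e" "u \<in> X" and e: "e \<in> edges G" "\<not> ends G e \<subseteq> X"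
    using assms(2) by (auto simp: cut_of_def)
  obtain v where "ends G e = {u, v}" "v \<in> verts G" "u \<in> verts G"
    using graph_endsE[OF assms(1) e(1) u(1)] by metis
  with u e that show ?thesis by auto
qed

lemma cut_compl:
  assumes "graph G"
  shows "cut_of G (verts G - X) = cut_of G X"
  using assms unfolding cut_of_def graph_def by auto

lemma edge_cut_iff:
  assumes "graph G"
  shows "edge_cut G K \<longleftrightarrow> (\<exists>X. X \<noteq> {} \<and> X \<subset> verts G \<and> K = cut_of G X)"
proof -
  have "{e \<in> edges G. ends G e \<inter> X \<noteq> {} \<and> ends G e \<inter> (verts G - X) \<noteq> {}} = cut_of G X" for X
    using assms unfolding cut_of_def graph_def by auto
  then show ?thesis
    unfolding edge_cut_def by simp
qed

lemma graph_delete_edges: "graph G \<Longrightarrow> graph (delete_edges G F)"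
  by (auto simp: graph_def delete_edges_def)

lemma cut_delete_edges: "cut_of (delete_edges G F) X = cut_of G X - F"
  by (auto simp: cut_of_def delete_edges_def)

section \<open>Reachability and bridges in terms of cuts\<close>

lemma reachable_closed:
  assumes "reachable G u v" "cut_of G X = {}" "u \<in> X"
  shows "v \<in> X"
  using assms(1) unfolding reachable_def
proof (induction rule: rtranclp_induct)
  case base
  show ?case by (rule assms(3))
next
  case (step y z)
  then show ?case
    using assms(2) by (auto simp: cut_of_def)
qed

lemma cut_reachable:
  assumes "graph G"
  shows "cut_of G {w. reachable G u w} = {}"
proof (rule equals0I)
  fix e
  assume e: "e \<in> cut_of G {w. reachable G u w}"
  obtain p q where pq: "ends G e = {p, q}" "reachable G u p" "\<not> reachable G u q"
    using cut_endsE[OF assms e] by (metis mem_Collect_eq)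
  have "e \<in> edges G"
    using e cut_subset_edges[of G] by blast
  with pq show False
    unfolding reachable_def by (metis (mono_tags, lifting) rtranclp.rtrancl_into_rtrancl)
qed

text \<open>Without \<open>e\<close>, the set reachable from one end of \<open>e\<close> can only be
  left through \<open>e\<close>; conversely, a walk avoiding \<open>e\<close> cannot leave
  \<open>X\<close>. In this form bridgelessness is carried along vertex maps by taking
  preimages.\<close>

lemma bridge_iff_cut:
  assumes "graph G"
  shows "bridge G e \<longleftrightarrow> (\<exists>X. cut_of G X = {e})"
proof
  assume "bridge G e"
  then obtain u v where e: "e \<in> edges G" "ends G e = {u, v}"
    and nr: "\<not> reachable (delete_edges G {e}) u v"
    by (auto simp: bridge_def)
  let ?X = "{w. reachable (delete_edges G {e}) u w}"
  have "cut_of G ?X - {e} = {}"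
    using cut_reachable[OF graph_delete_edges[OF assms], of "{e}" u] cut_delete_edges by metis
  moreover have "e \<in> cut_of G ?X"
    using e nr by (auto simp: cut_of_def reachable_def)
  ultimately show "\<exists>X. cut_of G X = {e}" by blast
next
  assume "\<exists>X. cut_of G X = {e}"
  then obtain X where X: "cut_of G X = {e}" by blast
  then have e: "e \<in> cut_of G X" by simp
  obtain u v where uv: "ends G e = {u, v}" "u \<in> X" "v \<notin> X"
    using cut_endsE[OF assms e] by metis
  have "\<not> reachable (delete_edges G {e}) u v"
    using reachable_closed[of "delete_edges G {e}" u v X] X uv by (auto simp: cut_delete_edges)
  then show "bridge G e"
    using uv e cut_subset_edges[of G X] unfolding bridge_def by blast
qed

lemma cut_of_not_connected:
  assumes "graph G" "verts G \<noteq> {}" "\<not> connected (delete_edges G F)"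
  obtains X where "X \<noteq> {}" "X \<subset> verts G" "cut_of G X \<subseteq> F"
proof -
  let ?H = "delete_edges G F"
  have V: "verts ?H = verts G" by (simp add: delete_edges_def)
  obtain u v where uv: "u \<in> verts G" "v \<in> verts G" "\<not> reachable ?H u v"
    using assms(2,3) V unfolding connected_def by auto
  let ?X = "{w. reachable ?H u w}"
  have "cut_of G ?X - F = {}"
    using cut_reachable[OF graph_delete_edges[OF assms(1)], of F u] cut_delete_edges by metis
  \<comment> \<open>Intersecting with the vertex set keeps the cut and makes inclusion in
    \<open>verts G\<close> immediate; \<open>v\<close> makes it proper.\<close>
  moreover have "cut_of G (?X \<inter> verts G) = cut_of G ?X"
    using assms(1) unfolding cut_of_def graph_def by blast
  ultimately have "cut_of G (?X \<inter> verts G) \<subseteq> F" by simp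
  moreover have "u \<in> ?X" by (simp add: reachable_def)
  ultimately show ?thesis
    using uv that[of "?X \<inter> verts G"] by auto
qed


section \<open>Transport of perfect matchings\<close>

lemma nu_triple:
  "nu [A, B, C] e = of_bool (e \<in> A) + of_bool (e \<in> B) + of_bool (e \<in> C)"
proof -
  have "{t. t < length [A, B, C] \<and> e \<in> [A, B, C] ! t} =
      (if e \<in> A then {0} else {}) \<union> (if e \<in> B then {1} else {}) \<union> (if e \<in> C then {2} else {})"
    by (auto simp: less_Suc_eq numeral_2_eq_2 intro: gr0I split: if_splits)
  then show ?thesis
    unfolding nu_def by simp
qed

lemma FR_triple_iff:
  "FR_triple G [A, B, C] \<longleftrightarrow>
     perfect_matching G A \<and> perfect_matching G B \<and> perfect_matching G C \<and> A \<inter> B \<inter> C = {}"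
  by (auto simp: FR_triple_def)

lemma FR_tripleE:
  assumes "FR_triple G C"
  obtains F1 F2 F3 where "C = [F1, F2, F3]" "FR_triple G [F1, F2, F3]"
  using assms unfolding FR_triple_def by blast

lemma perfect_matching_iff:
  "perfect_matching G F \<longleftrightarrow>
     F \<subseteq> edges G \<and> (\<forall>v\<in>verts G. \<exists>!e. e \<in> incident_edges G v \<and> e \<in> F)"
proof -
  have "(\<exists>!e. e \<in> F \<and> v \<in> ends G e) \<longleftrightarrow> (\<exists>!e. e \<in> incident_edges G v \<and> e \<in> F)"
    if "F \<subseteq> edges G" for v
    using that unfolding incident_edges_def by (intro arg_cong[where f = Ex1]) auto
  then show ?thesis
    unfolding perfect_matching_def by (simp cong: conj_cong)
qed

lemma Ex1_bij_betw:
  assumes "bij_betw \<rho> A B" "\<exists>!b. b \<in> B \<and> P b"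
  shows "\<exists>!a. a \<in> A \<and> P (\<rho> a)"
  using assms unfolding bij_betw_def inj_on_def by (metis imageE imageI)

text \<open>Being a perfect matching is a condition at each vertex separately, so bijections between
  the incident edges suffice.\<close>

lemma perfect_matching_pullback:
  assumes "perfect_matching H F"
    and "\<And>v. v \<in> verts G \<Longrightarrow> p v \<in> verts H"
    and "\<And>v. v \<in> verts G \<Longrightarrow> bij_betw q (incident_edges G v) (incident_edges H (p v))"
  shows "perfect_matching G {e \<in> edges G. q e \<in> F}"
  unfolding perfect_matching_iff
proof (intro conjI ballI)
  fix v
  assume v: "v \<in> verts G"
  then have "\<exists>!e. e \<in> incident_edges H (p v) \<and> e \<in> F"
    using assms(1,2) by (simp add: perfect_matching_iff)
  from Ex1_bij_betw[OF assms(3)[OF v] this]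
  show "\<exists>!e. e \<in> incident_edges G v \<and> e \<in> {e \<in> edges G. q e \<in> F}"
    by (simp add: incident_edges_def conj_ac)
qed auto

text \<open>At a vertex of \<open>X\<close> the set \<open>F2\<close> adds nothing to
  \<open>F1\<close>: an edge of \<open>F2\<close> seen there lies in both graphs, where the two
  matchings agree. The other side is symmetric. Only local injectivity of \<open>\<rho>\<close>
  matters, since for a 2-cut it maps both cut edges to one.\<close>

lemma perfect_matching_glue:
  assumes F1: "perfect_matching H1 F1" and F2: "perfect_matching H2 F2"
    and agree: "\<And>e. e \<in> edges H1 \<inter> edges H2 \<Longrightarrow> e \<in> F1 \<longleftrightarrow> e \<in> F2"
    and 1: "\<And>v. v \<in> X \<Longrightarrow> v \<in> verts H1 \<and> bij_betw \<rho> (incident_edges G v) (incident_edges H1 v)"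
    and 2: "\<And>v. v \<in> verts G - X \<Longrightarrow>
      v \<in> verts H2 \<and> bij_betw \<rho> (incident_edges G v) (incident_edges H2 v)"
  shows "perfect_matching G {e \<in> edges G. \<rho> e \<in> F1 \<union> F2}"
  unfolding perfect_matching_iff
proof (intro conjI ballI)
  have sub: "F1 \<subseteq> edges H1" "F2 \<subseteq> edges H2"
    using F1 F2 by (auto simp: perfect_matching_def)
  fix v
  assume "v \<in> verts G"
  then consider (X) "v \<in> X" | (Y) "v \<in> verts G - X" by auto
  then obtain H where b: "bij_betw \<rho> (incident_edges G v) (incident_edges H v)"
    and ex: "\<exists>!e. e \<in> incident_edges H v \<and> e \<in> F1 \<union> F2"
  proof cases
    case X
    have "e \<in> F1 \<union> F2 \<longleftrightarrow> e \<in> F1" if "e \<in> incident_edges H1 v" for e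
      using that agree[of e] sub by (auto simp: incident_edges_def)
    moreover have "\<exists>!e. e \<in> incident_edges H1 v \<and> e \<in> F1"
      using F1 1[OF X] by (simp add: perfect_matching_iff)
    ultimately show ?thesis
      using that[of H1] 1[OF X] by metis
  next
    case Y
    have "e \<in> F1 \<union> F2 \<longleftrightarrow> e \<in> F2" if "e \<in> incident_edges H2 v" for e
      using that agree[of e] sub by (auto simp: incident_edges_def)
    moreover have "\<exists>!e. e \<in> incident_edges H2 v \<and> e \<in> F2"
      using F2 2[OF Y] by (simp add: perfect_matching_iff)
    ultimately show ?thesis
      using that[of H2] 2[OF Y] by metis
  qed
  from Ex1_bij_betw[OF b ex]
  show "\<exists>!e. e \<in> incident_edges G v \<and> e \<in> {e \<in> edges G. \<rho> e \<in> F1 \<union> F2}"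
    by (simp add: incident_edges_def conj_ac)
qed auto


section \<open>Transfer to graphs over the natural numbers\<close>

text \<open>Finite sets inject into the natural numbers, so every counter-example has an isomorphic
  copy there. This lets minimality among graphs over \<open>nat\<close> be used for graphs over the
  types of \<open>G\<close>.\<close>

lemma counterexample_P_nat:
  fixes G :: "('v, 'e) multigraph"
  assumes "counterexample_P G e f i j"
  obtains H :: "(nat, nat) multigraph" and e' f'
  where "counterexample_P H e' f' i j" "card (verts H) = card (verts G)"
proof -
  have bc: "bridgeless_cubic G" and adj: "adjacent_edges G e f"
    and none: "\<not> (\<exists>C. FR_triple G C \<and> nu C e = i \<and> nu C f = j)"
    using assms by (auto simp: counterexample_P_def)
  have g: "graph G" and cub: "cubic G" using bc by (auto simp: bridgeless_cubic_def cubic_def)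
  obtain p :: "'v \<Rightarrow> nat" where p: "inj_on p (verts G)"
    using g by (metis graph_def finite_imp_inj_to_nat_seg)
  obtain q :: "'e \<Rightarrow> nat" where q: "inj_on q (edges G)"
    using g by (metis graph_def finite_imp_inj_to_nat_seg)
  define H where "H = \<lparr>verts = p ` verts G, edges = q ` edges G,
    ends = \<lambda>n. p ` ends G (inv_into (edges G) q n)\<rparr>"
  have vH: "verts H = p ` verts G" and eH: "edges H = q ` edges G"
    by (simp_all add: H_def)
  have endsH: "ends H (q x) = p ` ends G x" if "x \<in> edges G" for x
    using that q by (simp add: H_def)
  have sub: "ends G x \<subseteq> verts G" and two: "card (ends G x) = 2" if "x \<in> edges G" for x
    using that g by (auto simp: graph_def)
  have gH: "graph H"
    unfolding graph_def
  proof (intro conjI ballI)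
    fix n assume "n \<in> edges H"
    then obtain x where x: "x \<in> edges G" "n = q x" by (auto simp: eH)
    show "ends H n \<subseteq> verts H" using x sub by (auto simp: endsH vH)
    show "card (ends H n) = 2"
      using x sub two card_image[OF inj_on_subset[OF p sub]] by (simp add: endsH)
  qed (use g in \<open>auto simp: vH eH graph_def\<close>)
  have mem: "p v \<in> p ` ends G x \<longleftrightarrow> v \<in> ends G x" if "x \<in> edges G" "v \<in> verts G" for x v
    using p sub[OF that(1)] that(2) by (meson inj_on_image_mem_iff)
  have inc: "incident_edges H (p v) = q ` incident_edges G v" if "v \<in> verts G" for v
    using that by (auto simp: incident_edges_def eH endsH mem)
  have bij: "bij_betw q (incident_edges G v) (incident_edges H (p v))" if "v \<in> verts G" for v
    unfolding inc[OF that] using q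
    by (auto simp: bij_betw_def incident_edges_def intro: inj_on_subset)
  have "cubic H"
    unfolding cubic_def using gH cub bij_betw_same_card[OF bij]
    by (auto simp: vH cubic_def)
  moreover have "\<not> bridge H n" for n
  proof
    assume "bridge H n"
    then obtain Z where Z: "cut_of H Z = {n}" using gH by (auto simp: bridge_iff_cut)
    \<comment> \<open>A one-edge cut of the copy would pull back to a one-edge cut of
      \<open>G\<close>.\<close>
    have "q x \<in> cut_of H Z \<longleftrightarrow> x \<in> cut_of G (p -` Z)" if "x \<in> edges G" for x
      using that by (auto simp: cut_of_def eH endsH)
    then have eq: "q ` cut_of G (p -` Z) = cut_of H Z"
      using cut_subset_edges[of G "p -` Z"] cut_subset_edges[of H Z] unfolding eH by blast
    have "inj_on q (cut_of G (p -` Z))"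
      using q cut_subset_edges by (rule inj_on_subset)
    then have "card (cut_of G (p -` Z)) = 1"
      using card_image eq Z by fastforce
    then obtain x where "cut_of G (p -` Z) = {x}" by (auto simp: card_1_singleton_iff)
    then show False
      using bc bridge_iff_cut[OF g] by (auto simp: bridgeless_cubic_def)
  qed
  ultimately have bcH: "bridgeless_cubic H" by (simp add: bridgeless_cubic_def)
  have adjH: "adjacent_edges H (q e) (q f)"
  proof -
    have "e \<in> edges G" "f \<in> edges G" "e \<noteq> f" "ends G e \<inter> ends G f \<noteq> {}"
      using adj by (auto simp: adjacent_edges_def)
    then show ?thesis
      using q by (auto simp: adjacent_edges_def eH endsH inj_on_eq_iff)
  qed
  have "\<not> (\<exists>C. FR_triple H C \<and> nu C (q e) = i \<and> nu C (q f) = j)"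
  proof
    assume "\<exists>C. FR_triple H C \<and> nu C (q e) = i \<and> nu C (q f) = j"
    then obtain F1 F2 F3 where F: "FR_triple H [F1, F2, F3]"
      "nu [F1, F2, F3] (q e) = i" "nu [F1, F2, F3] (q f) = j"
      by (metis FR_tripleE)
    let ?M = "\<lambda>F. {e \<in> edges G. q e \<in> F}"
    have "perfect_matching G (?M F)" if "perfect_matching H F" for F
      using that by (rule perfect_matching_pullback) (use bij in \<open>auto simp: vH\<close>)
    then have "FR_triple G [?M F1, ?M F2, ?M F3]"
      using F(1) by (auto simp: FR_triple_iff)
    moreover have "nu [?M F1, ?M F2, ?M F3] e = i" "nu [?M F1, ?M F2, ?M F3] f = j"
      using adj F(2,3) by (auto simp: nu_triple adjacent_edges_def)
    ultimately show False
      using none by blast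
  qed
  then have "counterexample_P H (q e) (q f) i j"
    using assms bcH adjH by (auto simp: counterexample_P_def)
  moreover have "card (verts H) = card (verts G)"
    unfolding vH using p by (rule card_image)
  ultimately show ?thesis by (rule that)
qed


section \<open>Prescribing an FR-triple at a vertex\<close>

text \<open>(P) for a single graph: what minimality yields for each smaller bridgeless cubic
  graph.\<close>

definition satisfies_P :: "('v, 'e) multigraph \<Rightarrow> bool" where
  "satisfies_P H \<longleftrightarrow> bridgeless_cubic H \<and> (\<forall>e f i j. \<not> counterexample_P H e f i j)"

lemma satisfies_P_E:
  assumes "satisfies_P H" "e \<in> incident_edges H y" "f \<in> incident_edges H y" "e \<noteq> f"
    and "i \<le> 2" "j \<le> 2" "1 \<le> i + j" "i + j \<le> 3"
  obtains F1 F2 F3 where "FR_triple H [F1, F2, F3]"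
    "nu [F1, F2, F3] e = i" "nu [F1, F2, F3] f = j"
proof -
  have "adjacent_edges H e f"
    using assms(2-4) by (auto simp: adjacent_edges_def incident_edges_def)
  then obtain C where "FR_triple H C" "nu C e = i" "nu C f = j"
    using assms unfolding satisfies_P_def counterexample_P_def by blast
  then show ?thesis using that by (metis FR_tripleE)
qed

lemma perfect_matching_unique:
  assumes "perfect_matching H F" "y \<in> verts H" "e \<in> incident_edges H y" "f \<in> incident_edges H y"
    "e \<in> F" "f \<in> F"
  shows "e = f"
  using assms by (auto simp: perfect_matching_iff)

lemma perfect_matching_covers:
  assumes "perfect_matching H F" "y \<in> verts H"
  obtains e where "e \<in> incident_edges H y" "e \<in> F"
  using assms by (auto simp: perfect_matching_iff)

text \<open>(P) controls multiplicities only; reordering puts the matchings into prescribed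
  positions.\<close>

lemma FR_triple_permute:
  assumes "FR_triple H [A, B, C]"
  shows "FR_triple H [A, B, C]" "FR_triple H [A, C, B]" "FR_triple H [B, A, C]"
    "FR_triple H [B, C, A]" "FR_triple H [C, A, B]" "FR_triple H [C, B, A]"
  using assms by (auto simp: FR_triple_iff)

text \<open>(P) with multiplicities 2 and 1: no matching contains both edges at \<open>y\<close>, so
  two contain \<open>p\<close> and the remaining one contains \<open>r\<close>.\<close>

lemma FR_triple_prescribed_repeated:
  assumes "satisfies_P H" "y \<in> verts H"
    and "p \<in> incident_edges H y" "r \<in> incident_edges H y" "p \<noteq> r"
  obtains F1 F2 F3 where "FR_triple H [F1, F2, F3]" "p \<in> F1" "p \<in> F2" "r \<in> F3"
proof -
  obtain A B C where F: "FR_triple H [A, B, C]" "nu [A, B, C] p = 2" "nu [A, B, C] r = 1"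
    using satisfies_P_E[OF assms(1,3,4,5), of 2 1] by auto
  have "p \<in> M \<longrightarrow> r \<notin> M" if "perfect_matching H M" for M
    using perfect_matching_unique[OF that assms(2,3,4)] assms(5) by blast
  then have "p \<in> A \<longrightarrow> r \<notin> A" "p \<in> B \<longrightarrow> r \<notin> B" "p \<in> C \<longrightarrow> r \<notin> C"
    using F(1) by (simp_all add: FR_triple_iff)
  then have "(p \<in> A \<and> p \<in> B \<and> r \<in> C) \<or> (p \<in> A \<and> p \<in> C \<and> r \<in> B) \<or> (p \<in> B \<and> p \<in> C \<and> r \<in> A)"
    using F(2,3) unfolding nu_triple
    by (cases "p \<in> A"; cases "p \<in> B"; cases "p \<in> C"; cases "r \<in> A"; cases "r \<in> B"; cases "r \<in> C"; simp)
  then show ?thesis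
    using that FR_triple_permute[OF F(1)] by blast
qed

text \<open>(P) with multiplicities 1 and 1: the edges \<open>p\<close> and \<open>q\<close> lie in
  different matchings, and the third matching must cover \<open>y\<close> by the only edge left,
  \<open>r\<close>.\<close>

lemma FR_triple_prescribed_distinct:
  assumes "satisfies_P H" "y \<in> verts H"
    and p: "p \<in> incident_edges H y" "q \<in> incident_edges H y" "r \<in> incident_edges H y"
    and "p \<noteq> q" "p \<noteq> r" "q \<noteq> r"
  obtains F1 F2 F3 where "FR_triple H [F1, F2, F3]" "p \<in> F1" "q \<in> F2" "r \<in> F3"
proof -
  obtain A B C where F: "FR_triple H [A, B, C]" "nu [A, B, C] p = 1" "nu [A, B, C] q = 1"
    using satisfies_P_E[OF assms(1) p(1,2) assms(6), of 1 1] by auto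
  have "card (incident_edges H y) = 3"
    using assms(1,2) by (auto simp: satisfies_P_def bridgeless_cubic_def cubic_def)
  moreover have "{p, q, r} \<subseteq> incident_edges H y" "card {p, q, r} = 3"
    using p assms(6-8) by auto
  ultimately have "incident_edges H y = {p, q, r}"
    by (metis card.infinite card_subset_eq zero_neq_numeral)
  then have "(p \<in> M \<longrightarrow> q \<notin> M) \<and> (p \<in> M \<or> q \<in> M \<or> r \<in> M)" if "perfect_matching H M" for M
    using perfect_matching_unique[OF that assms(2) p(1,2)] assms(6)
      perfect_matching_covers[OF that assms(2)] by (metis insert_iff singletonD)
  then have "(p \<in> A \<longrightarrow> q \<notin> A) \<and> (p \<in> A \<or> q \<in> A \<or> r \<in> A)"
    "(p \<in> B \<longrightarrow> q \<notin> B) \<and> (p \<in> B \<or> q \<in> B \<or> r \<in> B)"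
    "(p \<in> C \<longrightarrow> q \<notin> C) \<and> (p \<in> C \<or> q \<in> C \<or> r \<in> C)"
    using F(1) by (simp_all add: FR_triple_iff)
  then have "(p \<in> A \<and> q \<in> B \<and> r \<in> C) \<or> (p \<in> A \<and> q \<in> C \<and> r \<in> B) \<or> (p \<in> B \<and> q \<in> A \<and> r \<in> C)
     \<or> (p \<in> B \<and> q \<in> C \<and> r \<in> A) \<or> (p \<in> C \<and> q \<in> A \<and> r \<in> B) \<or> (p \<in> C \<and> q \<in> B \<and> r \<in> A)"
    using F(2,3) unfolding nu_triple
    by (cases "p \<in> A"; cases "p \<in> B"; cases "p \<in> C"; cases "q \<in> A"; cases "q \<in> B"; cases "q \<in> C"; simp)
  then show ?thesis
    using that FR_triple_permute[OF F(1)] by blast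
qed

text \<open>The excluded choice is impossible for an FR-triple, as its matchings have no common
  edge. Otherwise the edges are distinct or exactly two of them coincide.\<close>

lemma FR_triple_prescribed_vertex:
  assumes "satisfies_P H" "y \<in> verts H"
    and p: "p1 \<in> incident_edges H y" "p2 \<in> incident_edges H y" "p3 \<in> incident_edges H y"
    and "\<not> (p1 = p2 \<and> p2 = p3)"
  obtains F1 F2 F3 where "FR_triple H [F1, F2, F3]" "p1 \<in> F1" "p2 \<in> F2" "p3 \<in> F3"
proof -
  consider "p1 \<noteq> p2" "p1 \<noteq> p3" "p2 \<noteq> p3" | "p1 = p2" "p1 \<noteq> p3" | "p1 = p3" "p1 \<noteq> p2"
    | "p2 = p3" "p2 \<noteq> p1"
    using assms(6) by blast
  then show ?thesis
  proof cases
    case 1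
    then show ?thesis
      using FR_triple_prescribed_distinct[OF assms(1,2) p] that by blast
  next
    case 2
    obtain A B C where "FR_triple H [A, B, C]" "p1 \<in> A" "p1 \<in> B" "p3 \<in> C"
      using FR_triple_prescribed_repeated[OF assms(1,2) p(1,3) 2(2)] .
    then show ?thesis using 2(1) that by blast
  next
    case 3
    obtain A B C where "FR_triple H [A, B, C]" "p1 \<in> A" "p1 \<in> B" "p2 \<in> C"
      using FR_triple_prescribed_repeated[OF assms(1,2) p(1,2) 3(2)] .
    then show ?thesis using 3(1) that FR_triple_permute(2) by blast
  next
    case 4
    obtain A B C where "FR_triple H [A, B, C]" "p2 \<in> A" "p2 \<in> B" "p1 \<in> C"
      using FR_triple_prescribed_repeated[OF assms(1,2) p(2,1) 4(2)] .
    then show ?thesis using 4(1) that FR_triple_permute(5) by blast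
  qed
qed

text \<open>Prescribing another edge at an end of \<open>a\<close> keeps \<open>a\<close> out of a
  matching, which reduces the claim to a prescription at a vertex.\<close>

lemma FR_triple_prescribed_edge:
  assumes "satisfies_P H" "a \<in> edges H" "\<not> (B1 \<and> B2 \<and> B3)"
  obtains F1 F2 F3 where "FR_triple H [F1, F2, F3]"
    "a \<in> F1 \<longleftrightarrow> B1" "a \<in> F2 \<longleftrightarrow> B2" "a \<in> F3 \<longleftrightarrow> B3"
proof -
  have g: "graph H" and c: "cubic H"
    using assms(1) by (auto simp: satisfies_P_def bridgeless_cubic_def cubic_def)
  have "ends H a \<noteq> {}" "ends H a \<subseteq> verts H" using g assms(2) by (auto simp: graph_def)
  then obtain y where y: "y \<in> verts H" and a: "a \<in> incident_edges H y"
    using assms(2) by (auto simp: incident_edges_def)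
  have "card (incident_edges H y - {a}) = 2"
    using c y a by (auto simp: cubic_def)
  then obtain b c where bc: "incident_edges H y - {a} = {b, c}" "b \<noteq> c"
    by (meson card_2_iff)
  then have i: "b \<in> incident_edges H y" "c \<in> incident_edges H y" "b \<noteq> a" "c \<noteq> a" by auto
  \<comment> \<open>The substitutes for \<open>a\<close> are not all the same edge, so the choice is
    admissible even if \<open>a\<close> is to be avoided by all three matchings.\<close>
  let ?p1 = "if B1 then a else b" and ?p2 = "if B2 then a else c" and ?p3 = "if B3 then a else c"
  have "?p1 \<in> incident_edges H y" "?p2 \<in> incident_edges H y" "?p3 \<in> incident_edges H y"
    "\<not> (?p1 = ?p2 \<and> ?p2 = ?p3)"
    using a i bc(2) assms(3) by auto
  then obtain F1 F2 F3 where F: "FR_triple H [F1, F2, F3]" "?p1 \<in> F1" "?p2 \<in> F2" "?p3 \<in> F3"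
    by (rule FR_triple_prescribed_vertex[OF assms(1) y])
  have "a \<in> M \<longleftrightarrow> B" if "perfect_matching H M" "(if B then a else d) \<in> M"
    "d \<in> incident_edges H y" "d \<noteq> a" for M B d
    using perfect_matching_unique[OF that(1) y a that(3)] that(2,4) by (auto split: if_splits)
  then show ?thesis
    using that F i unfolding FR_triple_iff by metis
qed


section \<open>Collapsing one side of a cut\<close>

definition retract :: "'v set \<Rightarrow> 'v \<Rightarrow> 'v \<Rightarrow> 'v" where
  "retract X w v = (if v \<in> X then v else w)"

text \<open>The vertices outside \<open>X\<close> are identified with \<open>w\<close> and the resulting loops are dropped. With
  \<open>w \<notin> X\<close> this is the usual contraction. If \<open>w \<in> X\<close> is the end of \<open>b\<close> and the cut is \<open>{a, b}\<close>, then
  \<open>b\<close> becomes a loop and \<open>a\<close> becomes the new edge joining the two ends of the cut in \<open>X\<close>.\<close>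

definition collapse :: "('v, 'e) multigraph \<Rightarrow> 'v set \<Rightarrow> 'v \<Rightarrow> ('v, 'e) multigraph" where
  "collapse G X w = \<lparr>verts = insert w X,
     edges = {e \<in> edges G. card (retract X w ` ends G e) = 2},
     ends = \<lambda>e. retract X w ` ends G e\<rparr>"

lemma verts_collapse [simp]: "verts (collapse G X w) = insert w X"
  by (simp add: collapse_def)

lemma graph_collapse:
  assumes "graph G" "X \<subseteq> verts G"
  shows "graph (collapse G X w)"
  using assms finite_subset[OF assms(2)]
  unfolding graph_def collapse_def by (auto simp: retract_def)

lemma edge_collapse_iff:
  assumes "ends G e = {u, v}"
  shows "e \<in> edges (collapse G X w) \<longleftrightarrow> e \<in> edges G \<and> retract X w u \<noteq> retract X w v"
  using assms by (auto simp: collapse_def card_insert_if)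

text \<open>The dropped edges have become loops, and a loop crosses no cut. Hence a collapse creates
  no new cuts and no bridges.\<close>

lemma cut_collapse:
  assumes "graph G"
  shows "cut_of (collapse G X w) Z = cut_of G (retract X w -` Z)"
proof (intro set_eqI iffI)
  fix e
  assume "e \<in> cut_of G (retract X w -` Z)"
  moreover from this obtain u v where "ends G e = {u, v}"
    "retract X w u \<in> Z" "retract X w v \<notin> Z"
    using cut_endsE[OF assms] by (metis vimage_eq)
  ultimately show "e \<in> cut_of (collapse G X w) Z"
    using edge_collapse_iff[of G e u v X w] by (auto simp: cut_of_def collapse_def)
qed (auto simp: cut_of_def collapse_def)

lemma bridgeless_collapse:
  assumes "bridgeless_cubic G" "X \<subseteq> verts G"
  shows "\<not> bridge (collapse G X w) e"
proof -
  have "graph G" using assms by (auto simp: bridgeless_cubic_def cubic_def)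
  then show ?thesis
    using assms by (auto simp: bridge_iff_cut graph_collapse cut_collapse bridgeless_cubic_def)
qed

lemma incident_collapse:
  assumes "graph G" "v \<in> X" "v \<noteq> w"
  shows "incident_edges (collapse G X w) v = incident_edges G v"
proof (intro set_eqI iffI)
  fix e
  assume "e \<in> incident_edges (collapse G X w) v"
  then show "e \<in> incident_edges G v"
    using assms(3) by (auto simp: incident_edges_def collapse_def retract_def split: if_splits)
next
  fix e
  assume e: "e \<in> incident_edges G v"
  then obtain u where "ends G e = {v, u}" "u \<noteq> v"
    using graph_endsE[OF assms(1)] by (metis (no_types, lifting) incident_edges_def mem_Collect_eq)
  with e assms(2,3) show "e \<in> incident_edges (collapse G X w) v"
    using edge_collapse_iff[of G e v u X w]
    by (auto simp: incident_edges_def collapse_def retract_def)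
qed

text \<open>The contracted vertex has degree 3 exactly when the cut has three edges.\<close>

lemma incident_collapse_new:
  assumes "graph G" "w \<notin> X"
  shows "incident_edges (collapse G X w) w = cut_of G X"
proof (intro set_eqI iffI)
  fix e
  assume e: "e \<in> incident_edges (collapse G X w) w"
  then have "e \<in> edges G" by (auto simp: incident_edges_def collapse_def)
  from e obtain v where v: "v \<in> ends G e" "v \<notin> X"
    using assms(2)
    by (auto simp: incident_edges_def collapse_def retract_def split: if_splits)
  obtain u where u: "ends G e = {v, u}"
    using graph_endsE[OF assms(1) \<open>e \<in> edges G\<close> v(1)] by metis
  then have "u \<in> X"
    using e edge_collapse_iff[OF u, of X w] v
    by (auto simp: incident_edges_def retract_def split: if_splits)
  then show "e \<in> cut_of G X" using u v \<open>e \<in> edges G\<close> by (auto simp: cut_of_def)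
next
  fix e
  assume e: "e \<in> cut_of G X"
  obtain u v where "ends G e = {u, v}" "u \<in> X" "v \<notin> X"
    using cut_endsE[OF assms(1) e] by metis
  with e assms(2) show "e \<in> incident_edges (collapse G X w) w"
    using edge_collapse_iff[of G e u v X w] cut_subset_edges[of G X]
    by (auto simp: incident_edges_def collapse_def retract_def)
qed

text \<open>Cut edges at \<open>w\<close> become loops and vanish; the other cut edges have their
  outer end moved to \<open>w\<close>.\<close>

lemma incident_collapse_old:
  assumes "graph G" "w \<in> X"
  shows "incident_edges (collapse G X w) w =
    (incident_edges G w - cut_of G X) \<union> (cut_of G X - incident_edges G w)"
proof (rule set_eqI)
  fix e
  show "e \<in> incident_edges (collapse G X w) w \<longleftrightarrow>
    e \<in> (incident_edges G w - cut_of G X) \<union> (cut_of G X - incident_edges G w)"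
  proof (cases "e \<in> edges G")
    case True
    then have "card (ends G e) = 2" using assms(1) by (simp add: graph_def)
    then obtain u v where uv: "ends G e = {u, v}" "u \<noteq> v" by (meson card_2_iff)
    have "e \<in> incident_edges (collapse G X w) w \<longleftrightarrow>
        retract X w u \<noteq> retract X w v \<and> (retract X w u = w \<or> retract X w v = w)"
      using edge_collapse_iff[OF uv(1), of X w] True uv
      by (auto simp: incident_edges_def collapse_def)
    also have "\<dots> \<longleftrightarrow> e \<in> (incident_edges G w - cut_of G X) \<union> (cut_of G X - incident_edges G w)"
      using uv True assms(2) by (auto simp: incident_edges_def cut_of_def retract_def)
    finally show ?thesis .
  qed (auto simp: incident_edges_def collapse_def cut_of_def)
qed

text \<open>An edge inside one side becomes a loop when that side is collapsed. So triples on the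
  two graphs need to agree only on the cut.\<close>

lemma edges_collapse_inter:
  assumes "graph G"
  shows "edges (collapse G X w) \<inter> edges (collapse G (verts G - X) w') \<subseteq> cut_of G X"
proof
  fix e
  assume e: "e \<in> edges (collapse G X w) \<inter> edges (collapse G (verts G - X) w')"
  then have eG: "e \<in> edges G" by (auto simp: collapse_def)
  then have "card (ends G e) = 2" "ends G e \<subseteq> verts G" using assms by (auto simp: graph_def)
  then obtain u v where uv: "ends G e = {u, v}" "u \<in> verts G" "v \<in> verts G"
    by (metis card_2_iff insert_subset)
  then show "e \<in> cut_of G X"
    using e eG edge_collapse_iff[OF uv(1)] by (auto simp: retract_def cut_of_def split: if_splits)
qed

lemma incident_collapse_uncut:
  assumes "graph G" "w \<in> X" "cut_of G X = {}" "v \<in> X"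
  shows "incident_edges (collapse G X w) v = incident_edges G v"
  using incident_collapse[OF assms(1,4), of w] incident_collapse_old[OF assms(1,2)] assms(3)
  by (cases "v = w") auto

text \<open>At \<open>w\<close> the edge \<open>b\<close> is replaced by \<open>a\<close>; no other
  vertex of \<open>X\<close> meets \<open>b\<close>, as \<open>w\<close> is its only end in
  \<open>X\<close>.\<close>

lemma bij_betw_incident_collapse:
  assumes "graph G" "w \<in> X" "w \<in> ends G b" "w \<notin> ends G a" "cut_of G X = {a, b}" "v \<in> X"
  shows "bij_betw (id(b := a)) (incident_edges G v) (incident_edges (collapse G X w) v)"
proof (cases "v = w")
  case True
  have "a \<notin> incident_edges G w" "b \<in> incident_edges G w"
    using assms cut_subset_edges[of G X] by (auto simp: incident_edges_def)
  then show ?thesis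
    unfolding True incident_collapse_old[OF assms(1,2)] assms(5)
    by (auto simp: bij_betw_def inj_on_def)
next
  case False
  have "b \<in> cut_of G X" using assms(5) by simp
  then obtain u u' where "ends G b = {u, u'}" "u \<in> X" "u' \<notin> X"
    using cut_endsE[OF assms(1)] by metis
  then have "b \<notin> incident_edges G v"
    using False assms(2,3,6) by (auto simp: incident_edges_def)
  then show ?thesis
    unfolding incident_collapse[OF assms(1,6) False]
    by (auto simp: bij_betw_def inj_on_def)
qed

text \<open>If both edges of a 2-cut met \<open>x \<in> X\<close>, moving \<open>x\<close> across would leave only the third edge at
  \<open>x\<close> in the cut.\<close>

lemma two_cut_disjoint_ends:
  assumes "bridgeless_cubic G" "X \<subseteq> verts G" "cut_of G X = {a, b}" "a \<noteq> b"
    and "x \<in> X" "x \<in> ends G b"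
  shows "x \<notin> ends G a"
proof
  assume xa: "x \<in> ends G a"
  have g: "graph G" using assms(1) by (auto simp: bridgeless_cubic_def cubic_def)
  have "{a, b} \<subseteq> incident_edges G x"
    using xa assms(3,6) cut_subset_edges[of G X] by (auto simp: incident_edges_def)
  moreover have "card (incident_edges G x) = 3"
    using assms(1,2,5) by (auto simp: bridgeless_cubic_def cubic_def)
  ultimately have "card (incident_edges G x - {a, b}) = 1"
    using assms(4) by (simp add: card_Diff_subset)
  then obtain c where c: "incident_edges G x - {a, b} = {c}"
    by (auto simp: card_1_singleton_iff)
  \<comment> \<open>Moving one vertex across changes the crossing status of exactly the edges at
    that vertex.\<close>
  have "cut_of G (X - {x}) = (cut_of G X - incident_edges G x) \<union> (incident_edges G x - cut_of G X)"
  proof (rule set_eqI)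
    fix e
    show "e \<in> cut_of G (X - {x}) \<longleftrightarrow>
      e \<in> (cut_of G X - incident_edges G x) \<union> (incident_edges G x - cut_of G X)"
    proof (cases "e \<in> edges G")
      case True
      then have "card (ends G e) = 2" using g by (simp add: graph_def)
      then obtain u v where "ends G e = {u, v}" "u \<noteq> v" by (meson card_2_iff)
      then show ?thesis
        using True assms(5) by (auto simp: cut_of_def incident_edges_def)
    qed (auto simp: cut_of_def incident_edges_def)
  qed
  then have "cut_of G (X - {x}) = {c}"
    using c assms(3) \<open>{a, b} \<subseteq> incident_edges G x\<close> by auto
  then show False
    using assms(1) bridge_iff_cut[OF g] by (auto simp: bridgeless_cubic_def)
qed


section \<open>Minimal counter-examples\<close>

text \<open>Minimality is stated over the types of \<open>G\<close>, because collapses reuse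
  vertices and edges of \<open>G\<close>.\<close>

locale minimal_counterexample =
  fixes G :: "('v, 'e) multigraph" and e f :: 'e and i j :: nat
  assumes counterexample: "counterexample_P G e f i j"
    and minimal: "\<And>(H :: ('v, 'e) multigraph) e' f' i' j'.
      counterexample_P H e' f' i' j' \<Longrightarrow> card (verts G) \<le> card (verts H)"
begin

lemma bridgeless_cubic: "bridgeless_cubic G"
  and adjacent: "adjacent_edges G e f"
  and no_FR_triple: "FR_triple G C \<Longrightarrow> nu C e = i \<Longrightarrow> nu C f \<noteq> j"
  and bounds: "i \<le> 2" "j \<le> 2" "1 \<le> i + j" "i + j \<le> 3"
  using counterexample by (auto simp: counterexample_P_def)

lemma cubic: "cubic G" and graph: "graph G" and finite_verts: "finite (verts G)"
  using bridgeless_cubic by (auto simp: bridgeless_cubic_def cubic_def graph_def)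

lemma card_incident: "v \<in> verts G \<Longrightarrow> card (incident_edges G v) = 3"
  using cubic by (simp add: cubic_def)

lemma common_vertex:
  obtains v where "v \<in> verts G" "e \<in> incident_edges G v" "f \<in> incident_edges G v" "e \<noteq> f"
  using adjacent graph unfolding adjacent_edges_def incident_edges_def graph_def by blast

text \<open>(P) for \<open>H1\<close> gives a triple with multiplicities \<open>i\<close> and
  \<open>j\<close> at the images of \<open>e\<close> and \<open>f\<close>. By \<open>extend\<close>
  it is matched on the shared edges by a triple of \<open>H2\<close>, and the preimages of the
  unions form an FR-triple of \<open>G\<close> with the forbidden multiplicities.\<close>

lemma glue:
  assumes P: "satisfies_P H1"
    and v: "v \<in> X" "e \<in> incident_edges G v" "f \<in> incident_edges G v"
    and 1: "\<And>v. v \<in> X \<Longrightarrow> v \<in> verts H1 \<and> bij_betw \<rho> (incident_edges G v) (incident_edges H1 v)"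
    and 2: "\<And>v. v \<in> verts G - X \<Longrightarrow>
      v \<in> verts H2 \<and> bij_betw \<rho> (incident_edges G v) (incident_edges H2 v)"
    and extend: "\<And>A1 A2 A3. FR_triple H1 [A1, A2, A3] \<Longrightarrow> \<exists>B1 B2 B3. FR_triple H2 [B1, B2, B3] \<and>
      (\<forall>e \<in> edges H1 \<inter> edges H2. (e \<in> A1 \<longleftrightarrow> e \<in> B1) \<and> (e \<in> A2 \<longleftrightarrow> e \<in> B2) \<and> (e \<in> A3 \<longleftrightarrow> e \<in> B3))"
  shows False
proof -
  have ef: "e \<noteq> f" using adjacent by (simp add: adjacent_edges_def)
  have inc1: "\<rho> x \<in> edges H1" if "x \<in> incident_edges G u" "u \<in> X" for x u
    using 1[OF that(2)] that(1) by (auto dest!: bij_betwE simp: incident_edges_def)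
  have inc2: "\<rho> x \<in> edges H2" if "x \<in> incident_edges G u" "u \<in> verts G - X" for x u
    using 2[OF that(2)] that(1) by (auto dest!: bij_betwE simp: incident_edges_def)
  have "\<rho> e \<in> incident_edges H1 v" "\<rho> f \<in> incident_edges H1 v" "\<rho> e \<noteq> \<rho> f"
    using 1[OF v(1)] v(2,3) ef by (auto simp: bij_betw_def inj_on_def)
  then obtain A1 A2 A3 where A: "FR_triple H1 [A1, A2, A3]"
    "nu [A1, A2, A3] (\<rho> e) = i" "nu [A1, A2, A3] (\<rho> f) = j"
    using satisfies_P_E[OF P] bounds by metis
  obtain B1 B2 B3 where B: "FR_triple H2 [B1, B2, B3]"
    and agree: "\<And>e. e \<in> edges H1 \<inter> edges H2 \<Longrightarrow>
      (e \<in> A1 \<longleftrightarrow> e \<in> B1) \<and> (e \<in> A2 \<longleftrightarrow> e \<in> B2) \<and> (e \<in> A3 \<longleftrightarrow> e \<in> B3)"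
    using extend[OF A(1)] by blast
  have sub: "A1 \<subseteq> edges H1" "A2 \<subseteq> edges H1" "A3 \<subseteq> edges H1"
    "B1 \<subseteq> edges H2" "B2 \<subseteq> edges H2" "B3 \<subseteq> edges H2"
    using A(1) B by (auto simp: FR_triple_iff perfect_matching_def)
  define M where "M A B = {e \<in> edges G. \<rho> e \<in> A \<union> B}" for A B
  have pm: "perfect_matching G (M A B)" if "perfect_matching H1 A" "perfect_matching H2 B"
    "\<And>e. e \<in> edges H1 \<inter> edges H2 \<Longrightarrow> e \<in> A \<longleftrightarrow> e \<in> B" for A B
    unfolding M_def using that 1 2 by (rule perfect_matching_glue)
  have "M A1 B1 \<inter> M A2 B2 \<inter> M A3 B3 = {}"
  proof (rule equals0I)
    fix x
    assume x: "x \<in> M A1 B1 \<inter> M A2 B2 \<inter> M A3 B3"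
    then have "x \<in> edges G" by (auto simp: M_def)
    then have "ends G x \<noteq> {}" "ends G x \<subseteq> verts G"
      using graph by (auto simp: graph_def)
    then obtain u where u: "u \<in> verts G" "x \<in> incident_edges G u"
      using \<open>x \<in> edges G\<close> by (auto simp: incident_edges_def)
    \<comment> \<open>A common edge would map to a common edge of the triple on the side that
      contains its end \<open>u\<close>.\<close>
    show False
    proof (cases "u \<in> X")
      case True
      then have "\<rho> x \<in> A1 \<inter> A2 \<inter> A3"
        using inc1[OF u(2)] x agree[of "\<rho> x"] sub by (auto simp: M_def)
      then show False using A(1) by (auto simp: FR_triple_iff)
    next
      case False
      then have "\<rho> x \<in> B1 \<inter> B2 \<inter> B3"
        using inc2[OF u(2)] u(1) x agree[of "\<rho> x"] sub by (auto simp: M_def)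
      then show False using B by (auto simp: FR_triple_iff)
    qed
  qed
  moreover have "perfect_matching G (M A1 B1)" "perfect_matching G (M A2 B2)"
    "perfect_matching G (M A3 B3)"
    using A(1) B agree unfolding FR_triple_iff by (blast intro!: pm)+
  ultimately have "FR_triple G [M A1 B1, M A2 B2, M A3 B3]"
    by (simp add: FR_triple_iff)
  moreover have "nu [M A1 B1, M A2 B2, M A3 B3] x = nu [A1, A2, A3] (\<rho> x)"
    if "x \<in> incident_edges G v" for x
  proof -
    have "x \<in> edges G" using that by (simp add: incident_edges_def)
    then have "x \<in> M A1 B1 \<longleftrightarrow> \<rho> x \<in> A1" "x \<in> M A2 B2 \<longleftrightarrow> \<rho> x \<in> A2" "x \<in> M A3 B3 \<longleftrightarrow> \<rho> x \<in> A3"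
      using inc1[OF that v(1)] agree[of "\<rho> x"] sub by (auto simp: M_def)
    then show ?thesis by (simp add: nu_triple)
  qed
  ultimately show False
    using no_FR_triple A v by metis
qed

text \<open>Bridgelessness is inherited and minimality excludes a counter-example, so for a small
  collapse only the degrees need checking.\<close>

lemma satisfies_P_collapse:
  assumes "X \<subseteq> verts G" "card (insert w X) < card (verts G)"
    and "\<And>v. v \<in> insert w X \<Longrightarrow> card (incident_edges (collapse G X w) v) = 3"
  shows "satisfies_P (collapse G X w)"
proof -
  have "cubic (collapse G X w)"
    using assms(3) graph_collapse[OF graph assms(1)] by (simp add: cubic_def)
  then have "bridgeless_cubic (collapse G X w)"
    using bridgeless_collapse[OF bridgeless_cubic assms(1)] by (simp add: bridgeless_cubic_def)
  then show ?thesis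
    using minimal[of "collapse G X w"] assms(2) unfolding satisfies_P_def by fastforce
qed

lemma card_proper: "X \<subset> verts G \<Longrightarrow> card X < card (verts G)"
  using finite_verts by (rule psubset_card_mono)

text \<open>A side and its complement have the same cut, so the side containing a common end of
  \<open>e\<close> and \<open>f\<close> can be called \<open>X\<close>.\<close>

lemma wlog_side:
  assumes "X \<noteq> {}" "X \<subset> verts G" "Q X" "Q (verts G - X)"
    and "\<And>X v. X \<noteq> {} \<Longrightarrow> X \<subset> verts G \<Longrightarrow> Q X \<Longrightarrow> Q (verts G - X) \<Longrightarrow> v \<in> X \<Longrightarrow>
      e \<in> incident_edges G v \<Longrightarrow> f \<in> incident_edges G v \<Longrightarrow> False"
  shows False
proof -
  obtain v where v: "v \<in> verts G" "e \<in> incident_edges G v" "f \<in> incident_edges G v"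
    using common_vertex by metis
  have "verts G - (verts G - X) = X" using assms(2) by auto
  then show False
    using assms(1-4) v assms(5)[of X v] assms(5)[of "verts G - X" v] by auto
qed

section \<open>Excluding small cuts\<close>

lemma cut_nonempty:
  assumes "X \<noteq> {}" "X \<subset> verts G"
  shows "cut_of G X \<noteq> {}"
proof
  assume c0: "cut_of G X = {}"
  show False
  proof (rule wlog_side[OF assms, of "\<lambda>X. cut_of G X = {}"])
    show "cut_of G X = {}" "cut_of G (verts G - X) = {}"
      using c0 cut_compl[OF graph] by simp_all
    fix X v
    assume X: "X \<noteq> {}" "X \<subset> verts G" and c: "cut_of G X = {}" "cut_of G (verts G - X) = {}"
      and v: "v \<in> X" "e \<in> incident_edges G v" "f \<in> incident_edges G v"
    let ?Y = "verts G - X"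
    \<comment> \<open>With no crossing edges, collapsing to a vertex of the kept side just restricts
      \<open>G\<close> to that side, so any \<open>w'\<close> will do.\<close>
    obtain w' where w': "w' \<in> ?Y" using X by auto
    let ?H1 = "collapse G X v" and ?H2 = "collapse G ?Y w'"
    have i1: "incident_edges ?H1 u = incident_edges G u" if "u \<in> X" for u
      using incident_collapse_uncut[OF graph v(1) c(1) that] .
    have i2: "incident_edges ?H2 u = incident_edges G u" if "u \<in> ?Y" for u
      using incident_collapse_uncut[OF graph w' c(2) that] .
    have P1: "satisfies_P ?H1"
      using X v card_proper[of X]
      by (intro satisfies_P_collapse) (auto simp: i1 card_incident insert_absorb)
    have P2: "satisfies_P ?H2"
      using X w' card_proper[of ?Y]
      by (intro satisfies_P_collapse) (auto simp: i2 card_incident insert_absorb)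
    have "card (incident_edges ?H2 w') = 3" using i2 w' card_incident by auto
    then have "incident_edges ?H2 w' \<noteq> {}" by auto
    then obtain a where a: "a \<in> edges ?H2" by (auto simp: incident_edges_def)
    \<comment> \<open>The prescription is arbitrary: the two sides share no edge, so any FR-triple
      of \<open>?H2\<close> works.\<close>
    obtain B1 B2 B3 where "FR_triple ?H2 [B1, B2, B3]"
      using FR_triple_prescribed_edge[OF P2 a, of False False False] by metis
    moreover have "edges ?H1 \<inter> edges ?H2 = {}"
      using edges_collapse_inter[OF graph, of X v w'] c by auto
    ultimately show False
      using glue[OF P1 v, of id ?H2] i1 i2 by auto
  qed
qed

text \<open>On each side both cut edges are replaced by one edge \<open>a\<close> joining their
  ends. A triple of one side uses \<open>a\<close> in at most two of its matchings, and the other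
  side can realise the same pattern; in \<open>G\<close> both cut edges inherit it.\<close>

lemma card_cut_neq_2:
  assumes "X \<noteq> {}" "X \<subset> verts G"
  shows "card (cut_of G X) \<noteq> 2"
proof
  assume "card (cut_of G X) = 2"
  then obtain a b where c0: "cut_of G X = {a, b}" and ab: "a \<noteq> b" by (meson card_2_iff)
  show False
  proof (rule wlog_side[OF assms, of "\<lambda>X. cut_of G X = {a, b}"])
    show "cut_of G X = {a, b}" "cut_of G (verts G - X) = {a, b}"
      using c0 cut_compl[OF graph] by simp_all
    fix X v
    assume X: "X \<noteq> {}" "X \<subset> verts G" and c: "cut_of G X = {a, b}" "cut_of G (verts G - X) = {a, b}"
      and v: "v \<in> X" "e \<in> incident_edges G v" "f \<in> incident_edges G v"
    let ?Y = "verts G - X"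
    have "b \<in> cut_of G X" using c by simp
    then obtain w w' where w: "ends G b = {w, w'}" "w \<in> X" "w' \<in> ?Y"
      using cut_endsE[OF graph] by (metis DiffI)
    let ?H1 = "collapse G X w" and ?H2 = "collapse G ?Y w'"
    \<comment> \<open>Otherwise \<open>a\<close> would become a loop as well, and the degree would
      drop.\<close>
    have na: "w \<notin> ends G a" "w' \<notin> ends G a"
      using two_cut_disjoint_ends[OF bridgeless_cubic _ c(1) ab, of w]
        two_cut_disjoint_ends[OF bridgeless_cubic _ c(2) ab, of w'] X w by auto
    have b1: "bij_betw (id(b := a)) (incident_edges G u) (incident_edges ?H1 u)" if "u \<in> X" for u
      using bij_betw_incident_collapse[OF graph w(2) _ na(1) c(1) that] w by simp
    have b2: "bij_betw (id(b := a)) (incident_edges G u) (incident_edges ?H2 u)" if "u \<in> ?Y" for u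
      using bij_betw_incident_collapse[OF graph w(3) _ na(2) c(2) that] w by simp
    have P1: "satisfies_P ?H1"
      using X w card_proper[of X] bij_betw_same_card[OF b1]
      by (intro satisfies_P_collapse) (auto simp: card_incident insert_absorb subset_iff)
    have P2: "satisfies_P ?H2"
      using X w card_proper[of ?Y] bij_betw_same_card[OF b2]
      by (intro satisfies_P_collapse) (auto simp: card_incident insert_absorb)
    have "b \<notin> edges ?H1"
      using w edge_collapse_iff[OF w(1), of X w] by (simp add: retract_def)
    then have inter: "edges ?H1 \<inter> edges ?H2 \<subseteq> {a}"
      using edges_collapse_inter[OF graph, of X w w'] c by auto
    have "b \<in> incident_edges G w'"
      using w c cut_subset_edges[of G X] by (auto simp: incident_edges_def)
    then have "(id(b := a)) b \<in> incident_edges ?H2 w'"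
      using b2[OF w(3)] bij_betwE by blast
    then have a: "a \<in> edges ?H2"
      by (simp add: incident_edges_def)
    show False
    proof (rule glue[OF P1 v, of "id(b := a)" ?H2])
      fix A1 A2 A3
      assume "FR_triple ?H1 [A1, A2, A3]"
      then have "\<not> (a \<in> A1 \<and> a \<in> A2 \<and> a \<in> A3)" by (auto simp: FR_triple_iff)
      from FR_triple_prescribed_edge[OF P2 a this] obtain B1 B2 B3
        where "FR_triple ?H2 [B1, B2, B3]" "a \<in> B1 \<longleftrightarrow> a \<in> A1" "a \<in> B2 \<longleftrightarrow> a \<in> A2" "a \<in> B3 \<longleftrightarrow> a \<in> A3"
        by metis
      then show "\<exists>B1 B2 B3. FR_triple ?H2 [B1, B2, B3] \<and> (\<forall>e \<in> edges ?H1 \<inter> edges ?H2.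
          (e \<in> A1 \<longleftrightarrow> e \<in> B1) \<and> (e \<in> A2 \<longleftrightarrow> e \<in> B2) \<and> (e \<in> A3 \<longleftrightarrow> e \<in> B3))"
        using inter by blast
    qed (use b1 b2 in auto)
  qed
qed

lemma card_cut_neq_1: "card (cut_of G X) \<noteq> 1"
  using bridgeless_cubic bridge_iff_cut[OF graph]
  by (auto simp: bridgeless_cubic_def card_1_singleton_iff)

text \<open>Each side is contracted to a vertex whose edges are the cut. A triple of one contraction
  uses one cut edge per matching, not always the same one, and the other contraction has a triple
  with these same choices.\<close>

lemma three_cut_trivial:
  assumes "X \<noteq> {}" "X \<subset> verts G" "card (cut_of G X) = 3"
  shows "card X = 1 \<or> card (verts G - X) = 1"
proof (rule ccontr)
  assume nt: "\<not> ?thesis"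
  let ?Q = "\<lambda>X. card (cut_of G X) = 3 \<and> card X \<noteq> 1"
  show False
  proof (rule wlog_side[OF assms(1,2), of ?Q])
    show "?Q X" "?Q (verts G - X)"
      using nt assms(3) cut_compl[OF graph] by auto
    fix X v
    assume X: "X \<noteq> {}" "X \<subset> verts G" and c: "?Q X" "?Q (verts G - X)"
      and v: "v \<in> X" "e \<in> incident_edges G v" "f \<in> incident_edges G v"
    let ?Y = "verts G - X"
    obtain w' where w': "w' \<in> ?Y" using X by auto
    \<comment> \<open>The new vertices borrow their names from the sides that are
      contracted.\<close>
    let ?H1 = "collapse G X w'" and ?H2 = "collapse G ?Y v"
    \<comment> \<open>The contracted side has at least two vertices, so even with the new vertex the
      graph is smaller than \<open>G\<close>.\<close>
    have small: "card (insert w Z) < card (verts G)"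
      if "Z \<subset> verts G" "card (verts G - Z) \<noteq> 1" for Z w
    proof -
      have fin: "finite Z" using that(1) finite_verts finite_subset by blast
      have "card (verts G - Z) = card (verts G) - card Z"
        using that(1) fin by (intro card_Diff_subset) auto
      then show ?thesis
        using that(2) card_proper[OF that(1)] fin by (auto simp: card_insert_if)
    qed
    have YY: "verts G - ?Y = X" using X by auto
    have i1: "incident_edges ?H1 u = incident_edges G u" if "u \<in> X" for u
      using incident_collapse[OF graph that, of w'] w' that by auto
    have i2: "incident_edges ?H2 u = incident_edges G u" if "u \<in> ?Y" for u
      using incident_collapse[OF graph that, of v] v that by auto
    have n1: "incident_edges ?H1 w' = cut_of G X"
      using incident_collapse_new[OF graph, of w' X] w' by simp
    have n2: "incident_edges ?H2 v = cut_of G X"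
      using incident_collapse_new[OF graph, of v ?Y] v cut_compl[OF graph] by simp
    have P1: "satisfies_P ?H1"
      using X c small[of X] by (intro satisfies_P_collapse) (auto simp: i1 n1 card_incident)
    have P2: "satisfies_P ?H2"
      using X c small[of ?Y] YY v
      by (intro satisfies_P_collapse) (auto simp: i2 n2 card_incident)
    have inter: "edges ?H1 \<inter> edges ?H2 \<subseteq> cut_of G X"
      using edges_collapse_inter[OF graph] .
    \<comment> \<open>The cut is the set of edges at one vertex, so one cut edge of a matching
      determines its whole trace on the cut.\<close>
    have agree: "x \<in> A \<longleftrightarrow> x \<in> B"
      if "perfect_matching ?H1 A" "perfect_matching ?H2 B" "p \<in> A" "p \<in> B" "p \<in> cut_of G X" "x \<in> cut_of G X"
      for A B p x
      using perfect_matching_unique[OF that(1), of w' p x]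
        perfect_matching_unique[OF that(2), of v p x] that(3-6) n1 n2 by auto
    show False
    proof (rule glue[OF P1 v, of id ?H2])
      fix A1 A2 A3
      assume A: "FR_triple ?H1 [A1, A2, A3]"
      have w'1: "w' \<in> verts ?H1" and v2: "v \<in> verts ?H2" by auto
      obtain p1 p2 p3 where p: "p1 \<in> cut_of G X" "p2 \<in> cut_of G X" "p3 \<in> cut_of G X"
        and pA: "p1 \<in> A1" "p2 \<in> A2" "p3 \<in> A3"
        using A perfect_matching_covers[OF _ w'1] unfolding FR_triple_iff n1 by metis
      then have "\<not> (p1 = p2 \<and> p2 = p3)" using A by (auto simp: FR_triple_iff)
      then obtain B1 B2 B3 where B: "FR_triple ?H2 [B1, B2, B3]" "p1 \<in> B1" "p2 \<in> B2" "p3 \<in> B3"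
        using FR_triple_prescribed_vertex[OF P2 v2, of p1 p2 p3] p unfolding n2 by metis
      have "(x \<in> A1 \<longleftrightarrow> x \<in> B1) \<and> (x \<in> A2 \<longleftrightarrow> x \<in> B2) \<and> (x \<in> A3 \<longleftrightarrow> x \<in> B3)" if "x \<in> cut_of G X" for x
        using A B p pA that agree unfolding FR_triple_iff by metis
      then show "\<exists>B1 B2 B3. FR_triple ?H2 [B1, B2, B3] \<and> (\<forall>e \<in> edges ?H1 \<inter> edges ?H2.
          (e \<in> A1 \<longleftrightarrow> e \<in> B1) \<and> (e \<in> A2 \<longleftrightarrow> e \<in> B2) \<and> (e \<in> A3 \<longleftrightarrow> e \<in> B3))"
        using inter B(1) by blast
    qed (use i1 i2 in auto)
  qed
qed

section \<open>Connectivity of a minimal counter-example\<close>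

lemma cut_singleton: "cut_of G {v} = incident_edges G v"
proof -
  have "\<not> ends G x \<subseteq> {v}" if "x \<in> edges G" for x
    using that graph card_mono[of "{v}" "ends G x"] by (auto simp: graph_def)
  then show ?thesis
    by (auto simp: cut_of_def incident_edges_def)
qed

text \<open>Disconnecting by fewer than three deletions would give a cut of size 0, 1 or 2. Size 1
  is a bridge; the other two are excluded by minimality.\<close>

lemma edge_connected_3: "edge_connected 3 G"
  unfolding edge_connected_def
proof (intro conjI allI impI)
  have "e \<in> edges G" using adjacent by (simp add: adjacent_edges_def)
  then have "card (ends G e) = 2" "ends G e \<subseteq> verts G"
    using graph by (auto simp: graph_def)
  then show V: "card (verts G) > 1"
    using card_mono[OF finite_verts, of "ends G e"] by simp
  fix F
  assume F: "F \<subseteq> edges G \<and> card F < 3"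
  show "connected (delete_edges G F)"
  proof (rule ccontr)
    assume "\<not> connected (delete_edges G F)"
    moreover have "verts G \<noteq> {}" using V by auto
    ultimately obtain X where X: "X \<noteq> {}" "X \<subset> verts G" "cut_of G X \<subseteq> F"
      using cut_of_not_connected[OF graph] by metis
    have fin: "finite F" using F graph finite_subset by (auto simp: graph_def)
    then have "card (cut_of G X) < 3" using X(3) F card_mono[OF fin X(3)] by simp
    moreover have "card (cut_of G X) \<noteq> 0"
      using cut_nonempty[OF X(1,2)] finite_subset[OF X(3) fin] by simp
    ultimately show False
      using card_cut_neq_1[of X] card_cut_neq_2[OF X(1,2)] by linarith
  qed
qed

lemma cyclically_4_edge_connected: "cyclically_4_edge_connected G"
  unfolding cyclically_4_edge_connected_def
proof (intro conjI allI impI)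
  fix K
  assume K: "edge_cut G K \<and> card K = 3"
  then obtain X where X: "X \<noteq> {}" "X \<subset> verts G" "K = cut_of G X"
    using edge_cut_iff[OF graph] by auto
  then consider "card X = 1" | "card (verts G - X) = 1"
    using three_cut_trivial K by metis
  then obtain Z where "card Z = 1" "Z \<subseteq> verts G" "cut_of G Z = K"
    using X cut_compl[OF graph, of X] by cases auto
  moreover from this obtain v where "Z = {v}"
    by (auto simp: card_1_singleton_iff)
  ultimately show "\<exists>v\<in>verts G. K = incident_edges G v"
    using cut_singleton by auto
qed (use cubic edge_connected_3 in auto)

end

theorem theorem2:
  fixes G :: "('v, 'e) multigraph" and e f :: 'e and i j :: nat
  assumes "\<not> property_P"
    and "counterexample_P G e f i j"
    and "\<forall>(H :: (nat, nat) multigraph) e' f' i' j'.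
           counterexample_P H e' f' i' j' \<longrightarrow> card (verts G) \<le> card (verts H)"
  shows "cyclically_4_edge_connected G"
proof -
  interpret minimal_counterexample G e f i j
  proof
    fix H :: "('v, 'e) multigraph" and e' f' i' j'
    assume "counterexample_P H e' f' i' j'"
    \<comment> \<open>The assumed minimality is applied to a copy of \<open>H\<close> over the
      natural numbers with equally many vertices.\<close>
    then show "card (verts G) \<le> card (verts H)"
      using counterexample_P_nat assms(3) by metis
  qed (rule assms(2))
  show ?thesis by (rule cyclically_4_edge_connected)
qed

end
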